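(* Let $\mathcal{X}$ be a Polish space, $X=(X_n)_{n\ge 1}$ an $\mathcal{X}$-valued process, and $P$ a random measure on $\mathcal{X}$. Consider the following statements: (i) $X$ is empirically weakly converging (EWC) almost surely with limit measure $P$; (ii) $\mathbb{P}\left[\forall f\in C_{\mathrm b}(\mathcal{X};\mathbb{R}),\ \limsup_{n}\lvert \eta_n^X f - Pf\rvert = 0\right]=1$; (iii) for all $f\in C_{\mathrm b}(\mathcal{X};\mathbb{R})$, $\lim_{n\to\infty}\eta_n^X f = Pf$, where the convergence is almost sure. Then (i) $\iff$ (ii) $\implies$ (iii). If, additionally, $\mathcal{X}$ is compact, then the implication (iii) $\implies$ (ii) also holds and all of the statements are equivalent.
   Context: All random variables are defined on a complete standard Borel probability space $(\Omega,\mathcal{A},\mathbb{P})$. Polish spaces carry their Borel $\sigma$-algebra. $\mathcal{P}(\mathcal{X})$ is the set of Borel probability measures on $\mathcal{X}$ with the topology of weak convergence (which is metrizable). A random measure on $\mathcal{X}$ is a measurable map $P:\Omega\to\mathcal{P}(\mathcal{X})$. $C_{\mathrm b}(\mathcal{X};\mathbb{R})$ is the set of continuous bounded real functions on $\mathcal{X}$, and $Pf:=\int_{\mathcal{X}} f\,\mathrm{d}P$. The empirical measure of a process $X$ is $\eta_n^X=\frac1n\sum_{i=1}^n\delta_{X_i}$. Definition (EWC): let $d$ be a metric on $\mathcal{P}(\mathcal{X})$ that metrizes weak convergence. An $\mathcal{X}$-valued process $X$ is EWC in probability (resp. almost surely) if there exists a random measure $P$ on $\mathcal{X}$ such that $\lim_{n\to\infty}d(\eta_n^X,P)=0$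 in probability (resp. almost surely); $P$ is then called a limit measure of $X$. *)

theory Defs
  imports "HOL-Probability.Probability"
begin

definition borel_of :: "'a topology \<Rightarrow> 'a measure" where
  "borel_of T = sigma (topspace T) {U. openin T U}"

definition standard_borel :: "'w measure \<Rightarrow> bool" where
  "standard_borel N \<longleftrightarrow>
     (\<exists>T. completely_metrizable_space T \<and> second_countable T \<and>
          topspace T = space N \<and> sets N = sets (borel_of T))"

definition complete_standard_borel_prob_space :: "'w measure \<Rightarrow> bool" where
  "complete_standard_borel_prob_space M \<longleftrightarrow>
     prob_space M \<and> (\<exists>N. standard_borel N \<and> M = completion N)"

definition borel_prob_measures :: "'a::topological_space measure set" where
  "borel_prob_measures = {\<mu>. prob_space \<mu> \<and> sets \<mu> = sets borel}"

text \<open>The topology of weak convergence is the coarsest topology on the Borel probability measures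
  that makes integration against every bounded continuous real function continuous. Here
  \<open>bcontfun\<close> is the library's set of bounded continuous functions.\<close>

definition weak_topology :: "'a::topological_space measure topology" where
  "weak_topology = topology_generated_by
     {{\<mu> \<in> borel_prob_measures. integral\<^sup>L \<mu> f \<in> U} | (f :: 'a \<Rightarrow> real) U. f \<in> bcontfun \<and> open U}"

definition metrizes_weak_convergence ::
    "('a::topological_space measure \<Rightarrow> 'a measure \<Rightarrow> real) \<Rightarrow> bool" where
  "metrizes_weak_convergence d \<longleftrightarrow>
     Metric_space borel_prob_measures d \<and>
     Metric_space.mtopology borel_prob_measures d = weak_topology"

definition random_measure :: "'w measure \<Rightarrow> ('w \<Rightarrow> 'a::topological_space measure) \<Rightarrow> bool" where
  "random_measure M P \<longleftrightarrow> P \<in> measurable M (borel_of weak_topology)"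

text \<open>Processes are indexed by the positive integers, so \<open>X 0\<close> is ignored throughout. The empirical
  measure of index \<open>0\<close> is a junk value (the null measure).\<close>

definition process :: "'w measure \<Rightarrow> (nat \<Rightarrow> 'w \<Rightarrow> 'a::topological_space) \<Rightarrow> bool" where
  "process M X \<longleftrightarrow> (\<forall>n\<ge>1. X n \<in> borel_measurable M)"

definition empirical_measure ::
    "(nat \<Rightarrow> 'w \<Rightarrow> 'a::topological_space) \<Rightarrow> nat \<Rightarrow> 'w \<Rightarrow> 'a measure" where
  "empirical_measure X n \<omega> =
     measure_of UNIV (sets borel)
       (\<lambda>A. ennreal (1 / real n) * (\<Sum>i = 1..n. emeasure (return borel (X i \<omega>)) A))"

text \<open>The set function above is countably additive, so \<open>measure_of\<close> does return it.\<close>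

lemma sets_empirical_measure: "sets (empirical_measure X n \<omega>) = sets borel"
  using sets.sigma_sets_eq[of borel] by (simp add: empirical_measure_def)

lemma emeasure_empirical_measure:
  fixes X :: "nat \<Rightarrow> 'w \<Rightarrow> 'a::topological_space"
  assumes "A \<in> sets borel"
  shows "emeasure (empirical_measure X n \<omega>) A =
    ennreal (1 / real n) * (\<Sum>i = 1..n. emeasure (return borel (X i \<omega>)) A)"
proof (rule emeasure_measure_of[OF empirical_measure_def])
  show "sets borel \<subseteq> Pow UNIV" by simp
  show "A \<in> sets (empirical_measure X n \<omega>)" using assms by (simp add: sets_empirical_measure)
  show "positive (sets (empirical_measure X n \<omega>))
     (\<lambda>A. ennreal (1 / real n) * (\<Sum>i = 1..n. emeasure (return borel (X i \<omega>)) A))"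
    by (simp add: positive_def)
  show "countably_additive (sets (empirical_measure X n \<omega>))
     (\<lambda>A. ennreal (1 / real n) * (\<Sum>i = 1..n. emeasure (return borel (X i \<omega>)) A))"
  proof (rule countably_additiveI)
    fix B :: "nat \<Rightarrow> 'a set"
    assume B: "range B \<subseteq> sets (empirical_measure X n \<omega>)" "disjoint_family B"
    have "(\<Sum>j. ennreal (1 / real n) * (\<Sum>i = 1..n. emeasure (return borel (X i \<omega>)) (B j)))
        = ennreal (1 / real n) * (\<Sum>i = 1..n. \<Sum>j. emeasure (return borel (X i \<omega>)) (B j))"
      by (simp add: suminf_sum)
    also have "\<dots> = ennreal (1 / real n) *
        (\<Sum>i = 1..n. emeasure (return borel (X i \<omega>)) (\<Union>j. B j))"
      using B by (intro arg_cong2[where f="(*)"] refl sum.cong suminf_emeasure)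
        (auto simp: sets_empirical_measure)
    finally show "(\<Sum>j. ennreal (1 / real n) * (\<Sum>i = 1..n. emeasure (return borel (X i \<omega>)) (B j)))
        = ennreal (1 / real n) * (\<Sum>i = 1..n. emeasure (return borel (X i \<omega>)) (\<Union>j. B j))" .
  qed
qed

definition EWC_almost_surely_with_limit ::
    "('a::topological_space measure \<Rightarrow> 'a measure \<Rightarrow> real) \<Rightarrow> 'w measure \<Rightarrow>
     (nat \<Rightarrow> 'w \<Rightarrow> 'a) \<Rightarrow> ('w \<Rightarrow> 'a measure) \<Rightarrow> bool" where
  "EWC_almost_surely_with_limit d M X P \<longleftrightarrow>
     random_measure M P \<and>
     (AE \<omega> in M. (\<lambda>n. d (empirical_measure X n \<omega>) (P \<omega>)) \<longlonglongrightarrow> 0)"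

end

theory Submission
  imports Defs
begin

text \<open>Since the metric \<open>d\<close> metrizes the weak topology, and a sequence converges in that topology iff
  its integrals against all bounded continuous functions converge, (i) and (ii) describe the same
  set of \<open>\<omega>\<close>; completeness of the probability space makes the set in (ii) measurable. If the space
  is compact, countably many partition-of-unity functions, subordinate to the balls of finite
  \<open>1/(m+1)\<close>-nets, have a uniformly dense linear span in the continuous functions, so the null sets
  in (iii) only need to be discarded for these functions.\<close>

section \<open>Convergence in the weak topology\<close>

lemma topspace_weak_topology:
  "topspace (weak_topology :: 'a::topological_space measure topology) = borel_prob_measures"
proof
  \<comment> \<open>Every measure integrates the zero function to \<open>0\<close>, so this function
    with an open \<open>U\<close> containing \<open>0\<close> makes all of
    \<open>borel_prob_measures\<close> a single generating set.\<close>
  have "(\<lambda>_. 0 :: real) \<in> (bcontfun :: ('a \<Rightarrow> real) set)"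
    by (simp add: const_bcontfun)
  then show "borel_prob_measures \<subseteq> topspace (weak_topology :: 'a measure topology)"
    unfolding weak_topology_def topology_generated_by_topspace by force
qed (auto simp: weak_topology_def topology_generated_by_topspace)

text \<open>The property of a set that it eventually contains \<open>g x\<close> once it contains
  \<open>l\<close> survives finite intersections and arbitrary unions, so testing the generators
  suffices.\<close>

lemma limitin_topology_generated_by:
  "limitin (topology_generated_by B) g l F \<longleftrightarrow>
    l \<in> \<Union>B \<and> (\<forall>U\<in>B. l \<in> U \<longrightarrow> eventually (\<lambda>x. g x \<in> U) F)"
proof
  assume "limitin (topology_generated_by B) g l F"
  then show "l \<in> \<Union>B \<and> (\<forall>U\<in>B. l \<in> U \<longrightarrow> eventually (\<lambda>x. g x \<in> U) F)"
    by (auto simp: limitin_def topology_generated_by_Basis topology_generated_by_topspace)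
next
  assume *: "l \<in> \<Union>B \<and> (\<forall>U\<in>B. l \<in> U \<longrightarrow> eventually (\<lambda>x. g x \<in> U) F)"
  have "generate_topology_on B U \<Longrightarrow> l \<in> U \<Longrightarrow> eventually (\<lambda>x. g x \<in> U) F" for U
  proof (induction rule: generate_topology_on.induct)
    case (UN K)
    \<comment> \<open>For a union, one member that contains \<open>l\<close> already captures
      \<open>g x\<close> eventually.\<close>
    then obtain k where k: "k \<in> K" "l \<in> k" by blast
    with UN.IH have "eventually (\<lambda>x. g x \<in> k) F" by blast
    with k show ?case by (auto elim: eventually_mono)
  qed (use * in \<open>auto intro: eventually_conj\<close>)
  with * show "limitin (topology_generated_by B) g l F"
    by (auto simp: limitin_def openin_topology_generated_by_iff topology_generated_by_topspace)
qed

text \<open>Membership in a generating set splits into being a probability measure, which the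
  assumption grants eventually, and having the integral in \<open>U\<close>; the latter, over all
  open \<open>U\<close>, is convergence of the integrals.\<close>

lemma limitin_weak_topology:
  fixes \<nu> :: "'a::topological_space measure"
  assumes "eventually (\<lambda>x. \<mu> x \<in> borel_prob_measures) F"
  shows "limitin weak_topology \<mu> \<nu> F \<longleftrightarrow> \<nu> \<in> borel_prob_measures \<and>
    (\<forall>f::'a \<Rightarrow> real. f \<in> bcontfun \<longrightarrow> ((\<lambda>x. integral\<^sup>L (\<mu> x) f) \<longlongrightarrow> integral\<^sup>L \<nu> f) F)"
    (is "_ \<longleftrightarrow> ?N \<and> ?C")
proof -
  define S where "S f U = {\<mu> \<in> borel_prob_measures. integral\<^sup>L \<mu> f \<in> U}"
    for f :: "'a \<Rightarrow> real" and U
  define B where "B = {S f U | f U. f \<in> bcontfun \<and> open U}"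
  have weak: "weak_topology = topology_generated_by B"
    by (simp add: weak_topology_def B_def S_def)
  have "\<Union>B = borel_prob_measures"
    unfolding topology_generated_by_topspace[symmetric] weak[symmetric] by (rule topspace_weak_topology)
  then have "limitin weak_topology \<mu> \<nu> F \<longleftrightarrow> ?N \<and> (\<forall>V\<in>B. \<nu> \<in> V \<longrightarrow> eventually (\<lambda>x. \<mu> x \<in> V) F)"
    by (simp only: weak limitin_topology_generated_by)
  also have "\<dots> \<longleftrightarrow> ?N \<and> (\<forall>f U. f \<in> bcontfun \<longrightarrow> open U \<longrightarrow> \<nu> \<in> S f U \<longrightarrow> eventually (\<lambda>x. \<mu> x \<in> S f U) F)"
    unfolding B_def by blast
  also have "\<dots> \<longleftrightarrow> ?N \<and> ?C"
    unfolding S_def mem_Collect_eq tendsto_def eventually_conj_iff using assms by auto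
  finally show ?thesis .
qed

text \<open>This removes the dependence on the choice of \<open>d\<close>. Only eventual membership
  is asked of \<open>\<mu>\<close>, because the empirical measure of index \<open>0\<close> is not a
  probability measure.\<close>

lemma tendsto_metrizes_weak_convergence:
  fixes \<nu> :: "'a::topological_space measure"
  assumes "metrizes_weak_convergence d" "\<nu> \<in> borel_prob_measures"
    and "eventually (\<lambda>x. \<mu> x \<in> borel_prob_measures) F"
  shows "((\<lambda>x. d (\<mu> x) \<nu>) \<longlongrightarrow> 0) F \<longleftrightarrow>
    (\<forall>f::'a \<Rightarrow> real. f \<in> bcontfun \<longrightarrow> ((\<lambda>x. integral\<^sup>L (\<mu> x) f) \<longlongrightarrow> integral\<^sup>L \<nu> f) F)"
proof -
  interpret Metric_space borel_prob_measures d
    using assms by (simp add: metrizes_weak_convergence_def)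
  have "((\<lambda>x. d (\<mu> x) \<nu>) \<longlongrightarrow> 0) F \<longleftrightarrow> limitin mtopology \<mu> \<nu> F"
    using assms by (simp add: limitin_metric_dist_null)
  then show ?thesis
    using assms limitin_weak_topology[of \<mu> F \<nu>] by (simp add: metrizes_weak_convergence_def)
qed

section \<open>Empirical measures and probability-one events\<close>

lemma empirical_measure_in_borel_prob_measures:
  assumes "n \<ge> 1"
  shows "empirical_measure X n \<omega> \<in> borel_prob_measures"
proof -
  have "emeasure (empirical_measure X n \<omega>) UNIV = ennreal (1 / real n) * of_nat n"
    by (simp add: emeasure_empirical_measure emeasure_return)
  also have "\<dots> = 1"
    using assms by (simp add: ennreal_of_nat_eq_real_of_nat flip: ennreal_mult')
  moreover have "space (empirical_measure X n \<omega>) = UNIV"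
    using sets_eq_imp_space_eq[OF sets_empirical_measure[of X n \<omega>]] by simp
  ultimately show ?thesis
    by (auto simp: borel_prob_measures_def sets_empirical_measure intro!: prob_spaceI)
qed

lemma random_measure_in_borel_prob_measures:
  assumes "random_measure M P" "\<omega> \<in> space M"
  shows "P \<omega> \<in> borel_prob_measures"
  using assms measurable_space[of P M "borel_of weak_topology" \<omega>]
  by (simp add: random_measure_def borel_of_def topspace_weak_topology space_measure_of_conv)

text \<open>The terms are nonnegative, so a limsup of \<open>0\<close> squeezes the liminf to
  \<open>0\<close> as well.\<close>

lemma limsup_abs_diff_eq_0_iff:
  fixes a :: "nat \<Rightarrow> real"
  shows "limsup (\<lambda>n. ereal \<bar>a n - l\<bar>) = 0 \<longleftrightarrow> a \<longlonglongrightarrow> l"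
proof -
  have "0 \<le> liminf (\<lambda>n. ereal \<bar>a n - l\<bar>)"
    by (intro Liminf_bounded) simp
  then have "limsup (\<lambda>n. ereal \<bar>a n - l\<bar>) = 0 \<longleftrightarrow> (\<lambda>n. ereal \<bar>a n - l\<bar>) \<longlonglongrightarrow> 0"
    using Liminf_le_Limsup[of sequentially "\<lambda>n. ereal \<bar>a n - l\<bar>"]
    by (auto simp: tendsto_iff_Liminf_eq_Limsup)
  also have "\<dots> \<longleftrightarrow> (\<lambda>n. \<bar>a n - l\<bar>) \<longlonglongrightarrow> 0"
    by (simp add: zero_ereal_def)
  also have "\<dots> \<longleftrightarrow> a \<longlonglongrightarrow> l"
    by (simp add: tendsto_rabs_zero_iff LIM_zero_iff)
  finally show ?thesis .
qed

text \<open>No measurability of \<open>Q\<close> is assumed: it will quantify over uncountably many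
  test functions. Each side of the equivalence yields it.\<close>

lemma (in prob_space) prob_eq_1_iff_AE_completion:
  assumes "M = completion N"
  shows "prob {\<omega> \<in> space M. Q \<omega>} = 1 \<longleftrightarrow> (AE \<omega> in M. Q \<omega>)"
proof
  assume *: "prob {\<omega> \<in> space M. Q \<omega>} = 1"
  \<comment> \<open>A non-measurable set has \<open>measure\<close> equal to the default
    \<open>0\<close>, so the value \<open>1\<close> excludes that case.\<close>
  then have "{\<omega> \<in> space M. Q \<omega>} \<in> events"
    by (metis measure_notin_sets zero_neq_one)
  with * show "AE \<omega> in M. Q \<omega>"
    by (auto dest: prob_eq_1)
next
  assume ae: "AE \<omega> in M. Q \<omega>"
  interpret complete_measure M
    unfolding assms by (rule completion.complete_measure_axioms)
  \<comment> \<open>The exceptional set lies inside a null set, so completeness makes it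
    measurable.\<close>
  have "{\<omega> \<in> space M. \<not> Q \<omega>} \<in> events"
    using ae by (simp add: AE_iff_null_sets null_setsD2)
  then have "{\<omega> \<in> space M. Q \<omega>} \<in> events"
    using sets.sets_Collect_neg by fastforce
  then show "prob {\<omega> \<in> space M. Q \<omega>} = 1"
    using ae by (simp add: prob_Collect_eq_1)
qed

section \<open>Reduction to countably many test functions on a compact space\<close>

lemma integrable_bcontfun:
  fixes f :: "'a::topological_space \<Rightarrow> real"
  assumes "\<mu> \<in> borel_prob_measures" "f \<in> bcontfun"
  shows "integrable \<mu> f"
proof -
  interpret prob_space \<mu> using assms by (simp add: borel_prob_measures_def)
  from assms obtain b where "\<And>x. norm (f x) \<le> b"
    by (auto simp: bcontfun_def bounded_iff)
  moreover have "f \<in> borel_measurable \<mu>"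
    using assms by (auto simp: bcontfun_def borel_prob_measures_def
      intro: borel_measurable_continuous_onI cong: measurable_cong_sets)
  ultimately show ?thesis
    by (intro integrable_const_bound[of _ b]) auto
qed

lemma bcontfun_compact:
  fixes f :: "'a::topological_space \<Rightarrow> 'b::metric_space"
  assumes "compact (UNIV :: 'a set)" "continuous_on UNIV f"
  shows "f \<in> bcontfun"
  using assms by (simp add: bcontfun_def compact_imp_bounded compact_continuous_image)

text \<open>The functions \<open>\<phi> m c\<close> depend neither on \<open>f\<close> nor on
  \<open>e\<close>, so a countable family serves all test functions. Where
  \<open>\<phi> m c x\<close> is nonzero, \<open>x\<close> is close to \<open>c\<close>, and uniform
  continuity bounds the error of replacing \<open>f x\<close> by \<open>f c\<close>.\<close>

lemma partition_of_unity_approximation: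
  assumes "compact (UNIV :: 'a::metric_space set)"
  obtains C :: "nat \<Rightarrow> 'a::metric_space set" and \<phi> :: "nat \<Rightarrow> 'a \<Rightarrow> 'a \<Rightarrow> real"
  where "\<And>m. finite (C m)" and "\<And>m c. c \<in> C m \<Longrightarrow> \<phi> m c \<in> bcontfun"
    and "\<And>f e. f \<in> bcontfun \<Longrightarrow> e > 0 \<Longrightarrow> \<exists>m. \<forall>x. \<bar>f x - (\<Sum>c\<in>C m. f c * \<phi> m c x)\<bar> \<le> (e::real)"
proof -
  define r where "r m = inverse (real (Suc m))" for m
  have r: "r m > 0" for m by (simp add: r_def)
  have "\<exists>K. finite K \<and> (UNIV :: 'a set) \<subseteq> (\<Union>c\<in>K. ball c (r m))" for m
    using assms[unfolded compact_eq_totally_bounded] r by blast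
  then obtain C :: "nat \<Rightarrow> 'a set"
    where C: "\<And>m. finite (C m)" "\<And>m. UNIV \<subseteq> (\<Union>c\<in>C m. ball c (r m))"
    by metis
  \<comment> \<open>A tent function, positive exactly on the ball of radius \<open>r m\<close> about
    \<open>c\<close>; dividing by the sum of the tents gives the partition of unity.\<close>
  define h where "h m c x = max 0 (r m - dist c x)" for m and c x :: 'a
  define s where "s m x = (\<Sum>c\<in>C m. h m c x)" for m x
  define \<phi> where "\<phi> m c x = h m c x / s m x" for m c x
  have h_nonneg: "h m c x \<ge> 0" for m c x by (simp add: h_def)
  \<comment> \<open>The balls cover the space, so some tent is positive at \<open>x\<close> and the
    division is legitimate.\<close>
  have s_pos: "s m x > 0" for m x
  proof -
    from C(2) obtain c where "c \<in> C m" "dist c x < r m" by (force simp: mem_ball)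
    then show ?thesis
      unfolding s_def by (intro sum_pos2[OF C(1)]) (auto simp: h_def)
  qed
  have cont: "continuous_on UNIV (\<phi> m c)" for m c
    unfolding \<phi>_def
    by (intro continuous_on_divide)
       (use s_pos in \<open>auto simp: s_def h_def less_imp_neq[THEN not_sym] intro!: continuous_intros\<close>)
  show ?thesis
  proof
    show "finite (C m)" for m by (rule C)
    show "\<phi> m c \<in> bcontfun" for m c using bcontfun_compact[OF assms cont] .
    fix f :: "'a \<Rightarrow> real" and e :: real
    assume f: "f \<in> bcontfun" and e: "e > 0"
    then have "uniformly_continuous_on UNIV f"
      using assms by (intro compact_uniformly_continuous) (auto simp: bcontfun_def)
    with e obtain \<delta> where \<delta>: "\<delta> > 0" "\<And>x y. dist x y < \<delta> \<Longrightarrow> \<bar>f x - f y\<bar> < e"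
      unfolding uniformly_continuous_on_def dist_real_def by (metis UNIV_I)
    then obtain m where m: "r m < \<delta>" unfolding r_def using reals_Archimedean by blast
    have "\<bar>f x - (\<Sum>c\<in>C m. f c * \<phi> m c x)\<bar> \<le> e" for x
    proof -
      have sum1: "(\<Sum>c\<in>C m. \<phi> m c x) = 1"
        using s_pos[of m x] by (simp add: \<phi>_def s_def flip: sum_divide_distrib)
      have term_le: "\<bar>(f x - f c) * \<phi> m c x\<bar> \<le> e * \<phi> m c x" for c
      proof (cases "dist c x < r m")
        case True
        with m have "\<bar>f x - f c\<bar> \<le> e" using \<delta>(2)[of x c] by (simp add: dist_commute)
        moreover have "\<phi> m c x \<ge> 0" using h_nonneg s_pos[of m x] by (simp add: \<phi>_def)
        ultimately show ?thesis by (simp add: abs_mult mult_right_mono)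
      \<comment> \<open>Outside the ball the tent vanishes, and both sides are
        \<open>0\<close>.\<close>
      qed (simp add: \<phi>_def h_def)
      \<comment> \<open>As the weights sum to \<open>1\<close>, \<open>f x\<close> is the weighted
        sum of the constant \<open>f x\<close>.\<close>
      have "f x - (\<Sum>c\<in>C m. f c * \<phi> m c x) = (\<Sum>c\<in>C m. (f x - f c) * \<phi> m c x)"
        by (simp add: left_diff_distrib sum_subtractf sum1 flip: sum_distrib_left)
      also have "\<bar>\<dots>\<bar> \<le> (\<Sum>c\<in>C m. e * \<phi> m c x)"
        by (intro order_trans[OF sum_abs] sum_mono term_le)
      also have "\<dots> = e" by (simp add: sum1 flip: sum_distrib_left)
      finally show ?thesis .
    qed
    then show "\<exists>m. \<forall>x. \<bar>f x - (\<Sum>c\<in>C m. f c * \<phi> m c x)\<bar> \<le> e" by blast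
  qed
qed

lemma abs_integral_diff_le:
  fixes f g :: "'a::topological_space \<Rightarrow> real"
  assumes "\<mu> \<in> borel_prob_measures" "integrable \<mu> f" "integrable \<mu> g"
    and "\<And>x. \<bar>f x - g x\<bar> \<le> e"
  shows "\<bar>integral\<^sup>L \<mu> f - integral\<^sup>L \<mu> g\<bar> \<le> e"
proof -
  interpret prob_space \<mu> using assms by (simp add: borel_prob_measures_def)
  have "\<bar>integral\<^sup>L \<mu> f - integral\<^sup>L \<mu> g\<bar> = \<bar>integral\<^sup>L \<mu> (\<lambda>x. f x - g x)\<bar>"
    using assms by simp
  also have "\<dots> \<le> integral\<^sup>L \<mu> (\<lambda>x. \<bar>f x - g x\<bar>)"
    by (rule integral_abs_bound)
  also have "\<dots> \<le> e"
    using assms by (intro integral_le_const) auto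
  finally show ?thesis .
qed

text \<open>A three-epsilon argument: replacing \<open>f\<close> by \<open>g\<close> costs at most
  \<open>e / 3\<close> under every probability measure, hence uniformly in the index.\<close>

lemma tendsto_integral_of_uniform_approximation:
  fixes f :: "'a::topological_space \<Rightarrow> real"
  assumes \<nu>: "\<nu> \<in> borel_prob_measures"
    and \<mu>: "eventually (\<lambda>n. \<mu> n \<in> borel_prob_measures) F"
    and f: "f \<in> bcontfun"
    and approx: "\<And>e. e > 0 \<Longrightarrow> \<exists>g\<in>bcontfun. (\<forall>x. \<bar>f x - g x\<bar> \<le> e) \<and>
      ((\<lambda>n. integral\<^sup>L (\<mu> n) g) \<longlongrightarrow> integral\<^sup>L \<nu> g) F"
  shows "((\<lambda>n. integral\<^sup>L (\<mu> n) f) \<longlongrightarrow> integral\<^sup>L \<nu> f) F"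
proof (rule tendstoI)
  fix e :: real assume "e > 0"
  then obtain g where g: "g \<in> bcontfun" "\<And>x. \<bar>f x - g x\<bar> \<le> e / 3"
    and lim: "((\<lambda>n. integral\<^sup>L (\<mu> n) g) \<longlongrightarrow> integral\<^sup>L \<nu> g) F"
    using approx[of "e / 3"] by auto
  have close: "\<bar>integral\<^sup>L \<kappa> f - integral\<^sup>L \<kappa> g\<bar> \<le> e / 3" if "\<kappa> \<in> borel_prob_measures" for \<kappa>
    using that f g by (intro abs_integral_diff_le integrable_bcontfun)
  have "eventually (\<lambda>n. dist (integral\<^sup>L (\<mu> n) g) (integral\<^sup>L \<nu> g) < e / 3) F"
    using lim \<open>e > 0\<close> by (intro tendstoD) auto
  with \<mu> show "eventually (\<lambda>n. dist (integral\<^sup>L (\<mu> n) f) (integral\<^sup>L \<nu> f) < e) F"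
  proof eventually_elim
    case (elim n)
    then show ?case using close[OF elim(1)] close[OF \<nu>] unfolding dist_real_def by linarith
  qed
qed

lemma AE_tendsto_all_bcontfun_compact:
  fixes \<mu> :: "nat \<Rightarrow> 'w \<Rightarrow> 'a::metric_space measure"
  assumes "compact (UNIV :: 'a set)"
    and \<nu>: "\<And>\<omega>. \<omega> \<in> space M \<Longrightarrow> \<nu> \<omega> \<in> borel_prob_measures"
    and \<mu>: "\<And>\<omega>. \<omega> \<in> space M \<Longrightarrow> eventually (\<lambda>n. \<mu> n \<omega> \<in> borel_prob_measures) sequentially"
    and lim: "\<And>f :: 'a \<Rightarrow> real. f \<in> bcontfun \<Longrightarrow>
      AE \<omega> in M. (\<lambda>n. integral\<^sup>L (\<mu> n \<omega>) f) \<longlonglongrightarrow> integral\<^sup>L (\<nu> \<omega>) f"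
  shows "AE \<omega> in M. \<forall>f :: 'a \<Rightarrow> real. f \<in> bcontfun \<longrightarrow>
    (\<lambda>n. integral\<^sup>L (\<mu> n \<omega>) f) \<longlonglongrightarrow> integral\<^sup>L (\<nu> \<omega>) f"
proof -
  obtain C :: "nat \<Rightarrow> 'a set" and \<phi> where C: "\<And>m. finite (C m)"
    and \<phi>: "\<And>m c. c \<in> C m \<Longrightarrow> \<phi> m c \<in> bcontfun"
    and approx: "\<And>f e. f \<in> bcontfun \<Longrightarrow> e > 0 \<Longrightarrow>
      \<exists>m. \<forall>x. \<bar>f x - (\<Sum>c\<in>C m. f c * \<phi> m c x)\<bar> \<le> (e::real)"
    by (rule partition_of_unity_approximation[OF assms(1)]) blast
  \<comment> \<open>The union of the null sets is taken over countably many \<open>m\<close> and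
    finitely many \<open>c\<close> for each; everything after this is argued for a fixed
    \<open>\<omega>\<close>.\<close>
  have "AE \<omega> in M. \<forall>m. \<forall>c\<in>C m. (\<lambda>n. integral\<^sup>L (\<mu> n \<omega>) (\<phi> m c)) \<longlonglongrightarrow> integral\<^sup>L (\<nu> \<omega>) (\<phi> m c)"
    unfolding AE_all_countable using C \<phi> lim by (simp add: AE_finite_all)
  then show ?thesis
  proof (rule AE_mp, intro AE_I2 impI allI)
    fix \<omega> f assume \<omega>: "\<omega> \<in> space M" and f: "f \<in> (bcontfun :: ('a \<Rightarrow> real) set)"
      and L: "\<forall>m. \<forall>c\<in>C m. (\<lambda>n. integral\<^sup>L (\<mu> n \<omega>) (\<phi> m c)) \<longlonglongrightarrow> integral\<^sup>L (\<nu> \<omega>) (\<phi> m c)"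
    show "(\<lambda>n. integral\<^sup>L (\<mu> n \<omega>) f) \<longlonglongrightarrow> integral\<^sup>L (\<nu> \<omega>) f"
    proof (rule tendsto_integral_of_uniform_approximation[OF \<nu>[OF \<omega>] \<mu>[OF \<omega>] f])
      fix e :: real assume "e > 0"
      then obtain m where m: "\<forall>x. \<bar>f x - (\<Sum>c\<in>C m. f c * \<phi> m c x)\<bar> \<le> e"
        using approx f by blast
      let ?g = "\<lambda>x. \<Sum>c\<in>C m. f c * \<phi> m c x"
      have g: "?g \<in> bcontfun"
        using \<phi> by (intro bcontfun_compact assms(1) continuous_intros) (auto simp: bcontfun_def)
      have int: "integral\<^sup>L \<kappa> ?g = (\<Sum>c\<in>C m. f c * integral\<^sup>L \<kappa> (\<phi> m c))"
        if "\<kappa> \<in> borel_prob_measures" for \<kappa>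
        using that \<phi> by (simp add: integrable_bcontfun)
      have "(\<lambda>n. \<Sum>c\<in>C m. f c * integral\<^sup>L (\<mu> n \<omega>) (\<phi> m c)) \<longlonglongrightarrow> integral\<^sup>L (\<nu> \<omega>) ?g"
        unfolding int[OF \<nu>[OF \<omega>]] using L by (intro tendsto_intros) auto
      \<comment> \<open>Linearity is available only where \<open>\<mu> n \<omega>\<close> is a
        probability measure, so the two sequences are matched eventually.\<close>
      then have "(\<lambda>n. integral\<^sup>L (\<mu> n \<omega>) ?g) \<longlonglongrightarrow> integral\<^sup>L (\<nu> \<omega>) ?g"
        by (rule Lim_transform_eventually) (use \<mu>[OF \<omega>] int in \<open>auto elim: eventually_mono\<close>)
      with g show "\<exists>g\<in>bcontfun. (\<forall>x. \<bar>f x - g x\<bar> \<le> e) \<and>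
          (\<lambda>n. integral\<^sup>L (\<mu> n \<omega>) g) \<longlonglongrightarrow> integral\<^sup>L (\<nu> \<omega>) g"
        using m by (intro bexI[of _ ?g] conjI)
    qed
  qed
qed

section \<open>The equivalences\<close>

theorem theorem3p4:
  fixes M :: "'w measure"
    and X :: "nat \<Rightarrow> 'w \<Rightarrow> 'a::polish_space"
    and P :: "'w \<Rightarrow> 'a measure"
    and d :: "'a measure \<Rightarrow> 'a measure \<Rightarrow> real"
  assumes "complete_standard_borel_prob_space M"
    and "metrizes_weak_convergence d"
    and "process M X"
    and "random_measure M P"
  shows
    "let i = EWC_almost_surely_with_limit d M X P;
         ii = (measure M {\<omega> \<in> space M. \<forall>f::'a \<Rightarrow> real. f \<in> bcontfun \<longrightarrow>
                limsup (\<lambda>n. ereal \<bar>integral\<^sup>L (empirical_measure X n \<omega>) f - integral\<^sup>L (P \<omega>) f\<bar>) = 0} = 1);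
         iii = (\<forall>f::'a \<Rightarrow> real. f \<in> bcontfun \<longrightarrow>
                (AE \<omega> in M. (\<lambda>n. integral\<^sup>L (empirical_measure X n \<omega>) f) \<longlonglongrightarrow> integral\<^sup>L (P \<omega>) f))
     in (i \<longleftrightarrow> ii) \<and> (ii \<longrightarrow> iii) \<and>
        (compact (UNIV :: 'a set) \<longrightarrow> (iii \<longrightarrow> ii) \<and> (i \<longleftrightarrow> ii) \<and> (ii \<longleftrightarrow> iii))"
proof -
  interpret prob_space M
    using assms by (simp add: complete_standard_borel_prob_space_def)
  obtain N where N: "M = completion N"
    using assms by (auto simp: complete_standard_borel_prob_space_def)
  define Q where "Q \<omega> \<longleftrightarrow> (\<forall>f::'a \<Rightarrow> real. f \<in> bcontfun \<longrightarrow>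
    (\<lambda>n. integral\<^sup>L (empirical_measure X n \<omega>) f) \<longlonglongrightarrow> integral\<^sup>L (P \<omega>) f)" for \<omega>
  have emp: "eventually (\<lambda>n. empirical_measure X n \<omega> \<in> borel_prob_measures) sequentially" for \<omega>
    using eventually_ge_at_top[of 1] by eventually_elim (rule empirical_measure_in_borel_prob_measures)
  have P: "P \<omega> \<in> borel_prob_measures" if "\<omega> \<in> space M" for \<omega>
    using assms(4) that by (rule random_measure_in_borel_prob_measures)
  \<comment> \<open>The metric criterion equals \<open>Q \<omega>\<close> for each
    \<open>\<omega>\<close> in \<open>space M\<close>, where \<open>P \<omega>\<close> is known to
    be a probability measure; the congruence rule supplies that membership.\<close>
  have i: "EWC_almost_surely_with_limit d M X P \<longleftrightarrow> (AE \<omega> in M. Q \<omega>)"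
    using assms(4) tendsto_metrizes_weak_convergence[OF assms(2) P emp]
    by (simp add: EWC_almost_surely_with_limit_def Q_def cong: AE_cong_simp)
  have ii: "measure M {\<omega> \<in> space M. \<forall>f::'a \<Rightarrow> real. f \<in> bcontfun \<longrightarrow>
      limsup (\<lambda>n. ereal \<bar>integral\<^sup>L (empirical_measure X n \<omega>) f - integral\<^sup>L (P \<omega>) f\<bar>) = 0} = 1
      \<longleftrightarrow> (AE \<omega> in M. Q \<omega>)"
    using prob_eq_1_iff_AE_completion[OF N] unfolding limsup_abs_diff_eq_0_iff Q_def .
  have "(AE \<omega> in M. Q \<omega>) \<Longrightarrow> f \<in> bcontfun \<Longrightarrow>
      AE \<omega> in M. (\<lambda>n. integral\<^sup>L (empirical_measure X n \<omega>) f) \<longlonglongrightarrow> integral\<^sup>L (P \<omega>) f"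
    for f :: "'a \<Rightarrow> real"
    by (erule AE_mp) (simp add: Q_def)
  moreover have "AE \<omega> in M. Q \<omega>"
    if "compact (UNIV :: 'a set)" and "\<And>f::'a \<Rightarrow> real. f \<in> bcontfun \<Longrightarrow>
      AE \<omega> in M. (\<lambda>n. integral\<^sup>L (empirical_measure X n \<omega>) f) \<longlonglongrightarrow> integral\<^sup>L (P \<omega>) f"
    unfolding Q_def by (intro AE_tendsto_all_bcontfun_compact that P emp)
  ultimately show ?thesis
    unfolding Let_def i ii by blast
qed

end
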